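(* Let $\mathbb{F}$ be a field of characteristic not two and let $\alpha,\beta,\gamma,\psi\in\mathbb{F}$ be arbitrary. The algebra $A(\alpha,\beta,\gamma,\psi)$ is a Jordan algebra.
   Context: Algebras are not assumed associative. A commutative $\mathbb{F}$-algebra is a Jordan algebra if its elements satisfy the identity $(x^2y)x=x^2(yx)$. Definition of $A(\alpha,\beta,\gamma,\psi)$: it is the commutative $\mathbb{F}$-algebra on a 9-dimensional $\mathbb{F}$-vector space with basis $e_1,\dots,e_9$, which are denoted respectively by the symbols $a,\ b,\ c,\ ab,\ bc,\ ac,\ a(bc),\ b(ac),\ c(ab)$ (as symbols, $xy$ and $yx$ are identified, and $x(yz)$ and $x(zy)$ are identified). Put $\lambda_{ab}=\lambda_{ba}=\alpha$, $\lambda_{bc}=\lambda_{cb}=\beta$, $\lambda_{ac}=\lambda_{ca}=\gamma$. The (commutative, bilinear) product $\cdot$ is given by the following formulas for every permutation $(x,y,z)$ of $(a,b,c)$: (1) $x\cdot x=x$, $\ x\cdot y=xy$, $\ x\cdot yz=x(yz)$; (2) $x\cdot xy=\frac12(\lambda_{xy}x+xy)$; (3) $x\cdot x(yz)=\frac12(\psi x+x(yz))$; (4) $x\cdot y(xz)=\frac14(\psi x+\lambda_{xz}\,xy+\lambda_{xy}\,xz+x(yz)+y(xz)-z(xy))$; (5) $xy\cdot xy=\frac{\lambda_{xy}}{4}(x+y)+\frac{\lambda_{xy}}{2}xy$; (6) $xy\cdot xz=\frac14(\psi x+\lambda_{xz}\,xy+\lambda_{xy}\,xz-x(yz)+y(xz)+z(xy))$;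 (7) $xy\cdot x(yz)=\frac18((\lambda_{xy}\lambda_{yz}+\psi)x+\psi y+2\psi\,xy+\lambda_{xy}\,yz+2\lambda_{xy}\,x(yz))$; (8) $xy\cdot z(xy)=\frac18(\lambda_{xy}\lambda_{yz}x+\lambda_{xy}\lambda_{xz}y+4\psi\,xy+\lambda_{xy}\,yz+\lambda_{xy}\,xz-2\lambda_{xy}\,x(yz)-2\lambda_{xy}\,y(xz)+4\lambda_{xy}\,z(xy))$; (9) $(x(yz))^2=\frac1{16}(\lambda_{yz}(\lambda_{xy}+\lambda_{xz}+2\psi)x+\lambda_{yz}\lambda_{xz}y+\lambda_{yz}\lambda_{xy}z+4\psi\,yz+(2\lambda_{yz}+8\psi)\,x(yz)-2\lambda_{yz}\,y(xz)-2\lambda_{yz}\,z(xy))$; (10) $x(yz)\cdot y(xz)=\frac1{16}(\lambda_{yz}(\lambda_{xz}+\psi)x+\lambda_{xz}(\lambda_{yz}+\psi)y+\lambda_{xy}\psi z+2\psi\,xy+2(\lambda_{xy}\lambda_{xz}+\psi)yz+2(\lambda_{xy}\lambda_{yz}+\psi)xz+(4\psi-\lambda_{xy}+\lambda_{yz}-\lambda_{xz})x(yz)+(4\psi-\lambda_{xy}-\lambda_{yz}+\lambda_{xz})y(xz)+(\lambda_{xy}-\lambda_{yz}-\lambda_{xz}-4\psi)z(xy))$. *)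

theory Defs
  imports "HOL-Analysis.Analysis"
begin

locale commutative_algebra = vector_space scale
  for scale :: "'f::field \<Rightarrow> 'v::ab_group_add \<Rightarrow> 'v" +
  fixes mult :: "'v \<Rightarrow> 'v \<Rightarrow> 'v"
  assumes linear_mult: "Vector_Spaces.linear scale scale (mult x)"
    and mult_commute: "mult x y = mult y x"

locale jordan_algebra = commutative_algebra +
  assumes jordan_identity: "mult (mult (mult x x) y) x = mult (mult x x) (mult y x)"

datatype gen = Ga | Gb | Gc

(* The third generator; the diagonal values of third are never used. *)
fun third :: "gen \<Rightarrow> gen \<Rightarrow> gen" where
  "third Ga Gb = Gc" | "third Gb Ga = Gc"
| "third Gb Gc = Ga" | "third Gc Gb = Ga"
| "third Ga Gc = Gb" | "third Gc Ga = Gb"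
| "third x _ = x"

fun nxt :: "gen \<Rightarrow> gen" where
  "nxt Ga = Gb" | "nxt Gb = Gc" | "nxt Gc = Ga"

(* The nine basis symbols. With {x, y, z} = {Ga, Gb, Gc}, the symbol xy = yx is M2 z (indexed by
   the generator that does not occur in it), and x(yz) = x(zy) is M3 x. So M2 Gc, M2 Ga, M2 Gb
   are ab, bc, ac, and M3 Ga, M3 Gb, M3 Gc are a(bc), b(ac), c(ab). *)
datatype mon = M1 gen | M2 gen | M3 gen

lemma UNIV_gen: "UNIV = {Ga, Gb, Gc}"
  using gen.exhaust by auto

lemma UNIV_mon: "UNIV = {M1 Ga, M1 Gb, M1 Gc, M2 Gc, M2 Ga, M2 Gb, M3 Ga, M3 Gb, M3 Gc}"
proof -
  have "m \<in> {M1 Ga, M1 Gb, M1 Gc, M2 Gc, M2 Ga, M2 Gb, M3 Ga, M3 Gb, M3 Gc}" for m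
    by (cases m; rename_tac x; case_tac x) auto
  then show ?thesis by blast
qed

instance gen :: finite
  by standard (simp add: UNIV_gen)

instance mon :: finite
  by standard (simp add: UNIV_mon)

lemma card_mon: "CARD(mon) = 9"
  by (simp add: UNIV_mon)

(* For distinct generators: bas1 x is x, bas2 x y is xy, and bas3 x is x(yz). *)
definition bas1 :: "gen \<Rightarrow> ('f::field)^mon" where "bas1 x = axis (M1 x) 1"
definition bas2 :: "gen \<Rightarrow> gen \<Rightarrow> ('f::field)^mon" where "bas2 x y = axis (M2 (third x y)) 1"
definition bas3 :: "gen \<Rightarrow> ('f::field)^mon" where "bas3 x = axis (M3 x) 1"

context
  fixes \<alpha> \<beta> \<gamma> \<psi> :: "'f::field"
begin

(* Only used for distinct arguments. *)
definition lam :: "gen \<Rightarrow> gen \<Rightarrow> 'f" where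
  "lam x y = (case third x y of Gc \<Rightarrow> \<alpha> | Ga \<Rightarrow> \<beta> | Gb \<Rightarrow> \<gamma>)"

(* x . xy *)
definition rhs2 :: "gen \<Rightarrow> gen \<Rightarrow> 'f^mon" where
  "rhs2 x y = (1/2) *s (lam x y *s bas1 x + bas2 x y)"

(* x . x(yz) *)
definition rhs3 :: "gen \<Rightarrow> 'f^mon" where
  "rhs3 x = (1/2) *s (\<psi> *s bas1 x + bas3 x)"

(* x . y(xz) *)
definition rhs4 :: "gen \<Rightarrow> gen \<Rightarrow> gen \<Rightarrow> 'f^mon" where
  "rhs4 x y z = (1/4) *s (\<psi> *s bas1 x + lam x z *s bas2 x y + lam x y *s bas2 x z
     + bas3 x + bas3 y - bas3 z)"

(* xy . xy *)
definition rhs5 :: "gen \<Rightarrow> gen \<Rightarrow> 'f^mon" where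
  "rhs5 x y = (lam x y / 4) *s (bas1 x + bas1 y) + (lam x y / 2) *s bas2 x y"

(* xy . xz *)
definition rhs6 :: "gen \<Rightarrow> gen \<Rightarrow> gen \<Rightarrow> 'f^mon" where
  "rhs6 x y z = (1/4) *s (\<psi> *s bas1 x + lam x z *s bas2 x y + lam x y *s bas2 x z
     - bas3 x + bas3 y + bas3 z)"

(* xy . x(yz) *)
definition rhs7 :: "gen \<Rightarrow> gen \<Rightarrow> gen \<Rightarrow> 'f^mon" where
  "rhs7 x y z = (1/8) *s ((lam x y * lam y z + \<psi>) *s bas1 x + \<psi> *s bas1 y + (2 * \<psi>) *s bas2 x y
     + lam x y *s bas2 y z + (2 * lam x y) *s bas3 x)"

(* xy . z(xy) *)
definition rhs8 :: "gen \<Rightarrow> gen \<Rightarrow> gen \<Rightarrow> 'f^mon" where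
  "rhs8 x y z = (1/8) *s ((lam x y * lam y z) *s bas1 x + (lam x y * lam x z) *s bas1 y
     + (4 * \<psi>) *s bas2 x y + lam x y *s bas2 y z + lam x y *s bas2 x z
     - (2 * lam x y) *s bas3 x - (2 * lam x y) *s bas3 y + (4 * lam x y) *s bas3 z)"

(* x(yz) . x(yz) *)
definition rhs9 :: "gen \<Rightarrow> gen \<Rightarrow> gen \<Rightarrow> 'f^mon" where
  "rhs9 x y z = (1/16) *s ((lam y z * (lam x y + lam x z + 2 * \<psi>)) *s bas1 x
     + (lam y z * lam x z) *s bas1 y + (lam y z * lam x y) *s bas1 z + (4 * \<psi>) *s bas2 y z
     + (2 * lam y z + 8 * \<psi>) *s bas3 x - (2 * lam y z) *s bas3 y - (2 * lam y z) *s bas3 z)"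

(* x(yz) . y(xz) *)
definition rhs10 :: "gen \<Rightarrow> gen \<Rightarrow> gen \<Rightarrow> 'f^mon" where
  "rhs10 x y z = (1/16) *s ((lam y z * (lam x z + \<psi>)) *s bas1 x
     + (lam x z * (lam y z + \<psi>)) *s bas1 y
     + (lam x y * \<psi>) *s bas1 z + (2 * \<psi>) *s bas2 x y
     + (2 * (lam x y * lam x z + \<psi>)) *s bas2 y z + (2 * (lam x y * lam y z + \<psi>)) *s bas2 x z
     + (4 * \<psi> - lam x y + lam y z - lam x z) *s bas3 x
     + (4 * \<psi> - lam x y - lam y z + lam x z) *s bas3 y
     + (lam x y - lam y z - lam x z - 4 * \<psi>) *s bas3 z)"

(* Products of basis vectors. The choice of order of the remaining two generators, made here with
   nxt, is immaterial: A_mult_basis and A_mult_unique below show that A_mult is the only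
   commutative bilinear product satisfying the rules for all permutations x, y, z. *)
fun basis_mult :: "mon \<Rightarrow> mon \<Rightarrow> 'f^mon" where
  "basis_mult (M1 x) (M1 y) = (if x = y then bas1 x else bas2 x y)"
| "basis_mult (M1 x) (M2 z) = (if x = z then bas3 x else rhs2 x (third x z))"
| "basis_mult (M2 z) (M1 x) = (if x = z then bas3 x else rhs2 x (third x z))"
| "basis_mult (M1 x) (M3 y) = (if x = y then rhs3 x else rhs4 x y (third x y))"
| "basis_mult (M3 y) (M1 x) = (if x = y then rhs3 x else rhs4 x y (third x y))"
| "basis_mult (M2 z) (M2 y) =
     (if y = z then rhs5 (nxt z) (nxt (nxt z)) else rhs6 (third y z) y z)"
| "basis_mult (M2 z) (M3 x) =
     (if x = z then rhs8 (nxt z) (nxt (nxt z)) z else rhs7 x (third x z) z)"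
| "basis_mult (M3 x) (M2 z) =
     (if x = z then rhs8 (nxt z) (nxt (nxt z)) z else rhs7 x (third x z) z)"
| "basis_mult (M3 x) (M3 y) =
     (if x = y then rhs9 x (nxt x) (nxt (nxt x)) else rhs10 x y (third x y))"

definition A_mult :: "'f^mon \<Rightarrow> 'f^mon \<Rightarrow> 'f^mon" where
  "A_mult p q = (\<Sum>i\<in>UNIV. \<Sum>j\<in>UNIV. (p $ i * q $ j) *s basis_mult i j)"

lemma third_commute: "x \<noteq> y \<Longrightarrow> third x y = third y x"
  by (cases x; cases y) auto

lemma basis_mult_commute: "basis_mult i j = basis_mult j i"
proof -
  have 6: "x \<noteq> y \<Longrightarrow> rhs6 (third x y) y x = rhs6 (third x y) x y" for x y
    by (cases x; cases y) (auto simp: rhs6_def lam_def bas2_def algebra_simps)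
  have 10: "x \<noteq> y \<Longrightarrow> rhs10 y x (third x y) = rhs10 x y (third x y)" for x y
    by (cases x; cases y) (auto simp: rhs10_def lam_def bas2_def algebra_simps)
  show ?thesis
    by (cases i; cases j) (auto simp: 6 10 bas2_def third_commute)
qed

lemma A_mult_commute: "A_mult p q = A_mult q p"
  unfolding A_mult_def
  by (subst sum.swap) (simp add: basis_mult_commute mult.commute)

lemma linear_A_mult: "Vector_Spaces.linear (*s) (*s) (A_mult p)"
  unfolding Vector_Spaces.linear_iff
proof (intro conjI allI)
  fix q r :: "'f^mon" and c :: 'f
  show "A_mult p (q + r) = A_mult p q + A_mult p r"
    by (simp add: A_mult_def distrib_left vec.scale_left_distrib sum.distrib)
  show "A_mult p (c *s q) = c *s A_mult p q"
    by (simp add: A_mult_def vec.scale_sum_right mult.left_commute)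
qed (rule vec.vector_space_axioms)+

lemma commutative_algebra_A_mult: "commutative_algebra (*s) A_mult"
  by (intro commutative_algebra.intro commutative_algebra_axioms.intro vec.vector_space_axioms
      linear_A_mult A_mult_commute)

lemma A_mult_axis: "A_mult (axis i 1) (axis j 1) = basis_mult i j"
proof -
  have "A_mult (axis i 1) (axis j 1) =
      (\<Sum>i'\<in>UNIV. \<Sum>j'\<in>UNIV. if j' = j then (if i' = i then basis_mult i' j' else 0) else 0)"
    unfolding A_mult_def axis_def by (intro sum.cong) auto
  then show ?thesis by simp
qed

definition is_A_product :: "('f^mon \<Rightarrow> 'f^mon \<Rightarrow> 'f^mon) \<Rightarrow> bool" where
  "is_A_product m \<longleftrightarrow> (\<forall>x y z. distinct [x, y, z] \<longrightarrow>
     m (bas1 x) (bas1 x) = bas1 x \<and> m (bas1 x) (bas1 y) = bas2 x y \<and>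
     m (bas1 x) (bas2 y z) = bas3 x \<and>
     m (bas1 x) (bas2 x y) = rhs2 x y \<and>
     m (bas1 x) (bas3 x) = rhs3 x \<and>
     m (bas1 x) (bas3 y) = rhs4 x y z \<and>
     m (bas2 x y) (bas2 x y) = rhs5 x y \<and>
     m (bas2 x y) (bas2 x z) = rhs6 x y z \<and>
     m (bas2 x y) (bas3 x) = rhs7 x y z \<and>
     m (bas2 x y) (bas3 z) = rhs8 x y z \<and>
     m (bas3 x) (bas3 x) = rhs9 x y z \<and>
     m (bas3 x) (bas3 y) = rhs10 x y z)"

lemma A_mult_basis: "is_A_product A_mult"
  unfolding is_A_product_def
proof (intro allI impI)
  fix x y z :: gen
  assume d: "distinct [x, y, z]"
  note defs = bas1_def bas2_def bas3_def A_mult_axis rhs2_def rhs3_def rhs4_def rhs5_def rhs6_def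
    rhs7_def rhs8_def rhs9_def rhs10_def lam_def
  show "A_mult (bas1 x) (bas1 x) = bas1 x \<and> A_mult (bas1 x) (bas1 y) = bas2 x y \<and>
     A_mult (bas1 x) (bas2 y z) = bas3 x \<and>
     A_mult (bas1 x) (bas2 x y) = rhs2 x y \<and>
     A_mult (bas1 x) (bas3 x) = rhs3 x \<and>
     A_mult (bas1 x) (bas3 y) = rhs4 x y z \<and>
     A_mult (bas2 x y) (bas2 x y) = rhs5 x y \<and>
     A_mult (bas2 x y) (bas2 x z) = rhs6 x y z \<and>
     A_mult (bas2 x y) (bas3 x) = rhs7 x y z \<and>
     A_mult (bas2 x y) (bas3 z) = rhs8 x y z \<and>
     A_mult (bas3 x) (bas3 x) = rhs9 x y z \<and>
     A_mult (bas3 x) (bas3 y) = rhs10 x y z"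
    using d by (cases x; cases y; cases z) (simp_all add: defs algebra_simps)
qed

lemma A_mult_unique:
  assumes "commutative_algebra (*s) m" "is_A_product m"
  shows "m = A_mult"
proof -
  interpret m: commutative_algebra "(*s)" m by fact
  interpret A: commutative_algebra "(*s)" A_mult by (rule commutative_algebra_A_mult)
  have basis: "m (bas1 x) (bas1 x) = bas1 x \<and> m (bas1 x) (bas1 y) = bas2 x y \<and>
     m (bas1 x) (bas2 y z) = bas3 x \<and>
     m (bas1 x) (bas2 x y) = rhs2 x y \<and> m (bas1 x) (bas3 x) = rhs3 x \<and>
     m (bas1 x) (bas3 y) = rhs4 x y z \<and>
     m (bas2 x y) (bas2 x y) = rhs5 x y \<and> m (bas2 x y) (bas2 x z) = rhs6 x y z \<and>
     m (bas2 x y) (bas3 x) = rhs7 x y z \<and> m (bas2 x y) (bas3 z) = rhs8 x y z \<and>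
     m (bas3 x) (bas3 x) = rhs9 x y z \<and> m (bas3 x) (bas3 y) = rhs10 x y z"
    if "distinct [x, y, z]" for x y z
    using assms(2) that unfolding is_A_product_def by blast
  note products = basis[of Ga Gb Gc, unfolded bas1_def bas2_def bas3_def, simplified]
    basis[of Ga Gc Gb, unfolded bas1_def bas2_def bas3_def, simplified]
    basis[of Gb Ga Gc, unfolded bas1_def bas2_def bas3_def, simplified]
    basis[of Gb Gc Ga, unfolded bas1_def bas2_def bas3_def, simplified]
    basis[of Gc Ga Gb, unfolded bas1_def bas2_def bas3_def, simplified]
    basis[of Gc Gb Ga, unfolded bas1_def bas2_def bas3_def, simplified]
  have sym: "rhs5 Gc Ga = rhs5 Ga Gc" "rhs8 Gc Ga Gb = rhs8 Ga Gc Gb"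
    "rhs9 Gb Ga Gc = rhs9 Gb Gc Ga"
    by (simp_all add: rhs5_def rhs8_def rhs9_def lam_def bas2_def algebra_simps)
  define rank where "rank i = (case i of M1 _ \<Rightarrow> 1 | M2 _ \<Rightarrow> 2 | M3 _ \<Rightarrow> (3::nat))" for i
  have ordered: "m (axis i 1) (axis j 1) = basis_mult i j" if "rank i \<le> rank j" for i j
  proof (cases i)
    case i: (M1 x)
    show ?thesis
      by (cases j; rename_tac y; case_tac x; case_tac y)
        (simp_all add: i products sym bas1_def bas2_def bas3_def)
  next
    case i: (M2 x)
    show ?thesis using that
      by (cases j; rename_tac y; case_tac x; case_tac y)
        (simp_all add: i rank_def products sym bas1_def bas2_def bas3_def)
  next
    case i: (M3 x)
    show ?thesis using that
      by (cases j; rename_tac y; case_tac x; case_tac y)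
        (simp_all add: i rank_def products sym bas1_def bas2_def bas3_def)
  qed
  have ax: "m (axis i 1) (axis j 1) = A_mult (axis i 1) (axis j 1)" for i j
    using ordered[of i j] ordered[of j i] m.mult_commute[of "axis i 1" "axis j 1"]
      basis_mult_commute[of i j] by (cases "rank i \<le> rank j") (simp_all add: A_mult_axis)
  have lin: "Vector_Spaces.linear (*s) (*s) (\<lambda>p. n p q)"
    if "commutative_algebra (*s) n" for n :: "'f^mon \<Rightarrow> 'f^mon \<Rightarrow> 'f^mon" and q
  proof -
    interpret n: commutative_algebra "(*s)" n by fact
    have "(\<lambda>p. n p q) = n q" using n.mult_commute by blast
    then show ?thesis using n.linear_mult by simp
  qed
  have *: "n p q = (\<Sum>i\<in>UNIV. \<Sum>j\<in>UNIV. (p $ i * q $ j) *s n (axis i 1) (axis j 1))"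
    if n: "commutative_algebra (*s) n" for n :: "'f^mon \<Rightarrow> 'f^mon \<Rightarrow> 'f^mon" and p q
  proof -
    interpret n: commutative_algebra "(*s)" n by fact
    interpret L: Vector_Spaces.linear "(*s)" "(*s)" "\<lambda>a. n a b" for b by (rule lin[OF n])
    interpret R: Vector_Spaces.linear "(*s)" "(*s)" "n a" for a by (rule n.linear_mult)
    have "n p q = n (\<Sum>i\<in>UNIV. p $ i *s axis i 1) (\<Sum>j\<in>UNIV. q $ j *s axis j 1)"
      by (simp add: basis_expansion)
    also have "\<dots> = (\<Sum>i\<in>UNIV. \<Sum>j\<in>UNIV. (p $ i * q $ j) *s n (axis i 1) (axis j 1))"
      by (simp only: L.sum L.scale R.sum R.scale vec.scale_sum_right vec.scale_scale)
        (subst sum.swap, simp only: mult.commute)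
    finally show ?thesis .
  qed
  show ?thesis
  proof (intro ext)
    show "m p q = A_mult p q" for p q
      by (simp only: *[OF assms(1), of p q] *[OF commutative_algebra_A_mult, of p q] ax)
  qed
qed

end

end

(* The algebra is special. Let a, b, c be rank one idempotents e_i = u_i f_i in an associative
   algebra, with g_ij = f_i u_j, so g_ii = 1. A word from e_i to e_j is a product of Gram entries g
   times u_i f_j, and (u_i f_j)(u_k f_l) = g_jk u_i f_l. If lambda_ij = g_ij g_ji and 2 psi is the
   sum of the two cyclic products g_ab g_bc g_ca and g_ac g_cb g_ba, the symbols of A multiply like
   Jordan products of the e_i. To cover degenerate parameters, the entries g are not chosen in a
   field: the coefficients of u_i f_j that occur form a free module of rank two, and the
   compositions of these nine modules are associative. The resulting embedding into an associative
   algebra of dimension 18, with product X G Y for the Gram matrix G, is injective because the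
   characteristic is not two. *)

theory Submission
  imports Defs
begin

text \<open>With \<open>X = \<phi> x\<close> and \<open>Z = X X\<close>, associativity gives
  \<open>X Z = Z X\<close>, so symmetrizing with \<open>X\<close> and with \<open>Z\<close> commute
  as operations on \<open>Y\<close>; injectivity pulls this back.\<close>

lemma (in commutative_algebra) jordan_algebraI_special:
  fixes m :: "'r::ab_group_add \<Rightarrow> 'r \<Rightarrow> 'r" and \<phi> :: "'v \<Rightarrow> 'r"
  assumes add_left: "\<And>x y z. m (x + y) z = m x z + m y z"
    and add_right: "\<And>x y z. m x (y + z) = m x y + m x z"
    and assoc: "\<And>x y z. m (m x y) z = m x (m y z)"
    and torsion: "\<And>x y :: 'r. x + x = y + y \<Longrightarrow> x = y"
    and inj: "inj \<phi>"
    and hom: "\<And>x y. \<phi> (mult x y) + \<phi> (mult x y) = m (\<phi> x) (\<phi> y) + m (\<phi> y) (\<phi> x)"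
  shows "jordan_algebra scale mult"
proof unfold_locales
  fix x y
  have square: "\<phi> (mult x x) = m (\<phi> x) (\<phi> x)"
    by (rule torsion) (rule hom)
  define X Y where "X = \<phi> x" and "Y = \<phi> y"
  define Z where "Z = m X X"
  define u v where "u = mult (mult x x) y" and "v = mult y x"
  have u: "\<phi> u + \<phi> u = m Z Y + m Y Z"
    using hom[of "mult x x" y] by (simp only: u_def square X_def Y_def Z_def)
  have v: "\<phi> v + \<phi> v = m Y X + m X Y"
    using hom[of y x] by (simp only: v_def X_def Y_def)
  \<comment> \<open>The target allows cancelling a doubling but has no halves, so both sides are
    taken four times.\<close>
  have "(\<phi> (mult u x) + \<phi> (mult u x)) + (\<phi> (mult u x) + \<phi> (mult u x)) =
      (m (\<phi> u) X + m X (\<phi> u)) + (m (\<phi> u) X + m X (\<phi> u))"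
    by (simp only: hom[of u x] X_def)
  also have "\<dots> = m (\<phi> u + \<phi> u) X + m X (\<phi> u + \<phi> u)"
    by (simp only: add_left add_right ac_simps)
  also have "\<dots> = m Z (\<phi> v + \<phi> v) + m (\<phi> v + \<phi> v) Z"
    by (simp only: u v add_left add_right Z_def assoc ac_simps)
  also have "\<dots> = (m Z (\<phi> v) + m (\<phi> v) Z) + (m Z (\<phi> v) + m (\<phi> v) Z)"
    by (simp only: add_left add_right ac_simps)
  also have "\<dots> = (\<phi> (mult (mult x x) v) + \<phi> (mult (mult x x) v)) +
      (\<phi> (mult (mult x x) v) + \<phi> (mult (mult x x) v))"
    by (simp only: hom[of "mult x x" v] square X_def Z_def)
  finally have "\<phi> (mult u x) = \<phi> (mult (mult x x) v)"
    by (rule torsion[OF torsion])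
  then show "mult (mult (mult x x) y) x = mult (mult x x) (mult y x)"
    using inj by (simp add: inj_eq u_def v_def)
qed

text \<open>Homogeneity is not assumed, so agreement is tested on all multiples of the basis
  vectors.\<close>

lemma additive_eqI:
  fixes f g :: "'f::field^'n \<Rightarrow> 'r::ab_group_add"
  assumes "Modules.additive f" "Modules.additive g"
    and "\<And>c i. f (c *s axis i 1) = g (c *s axis i 1)"
  shows "f v = g v"
proof -
  have "f (\<Sum>i\<in>UNIV. v $ i *s axis i 1) = g (\<Sum>i\<in>UNIV. v $ i *s axis i 1)"
    by (simp only: Modules.additive.sum[OF assms(1)] Modules.additive.sum[OF assms(2)] assms(3))
  then show ?thesis by (simp add: basis_expansion)
qed

lemma two_neq_zero:
  assumes "CHAR('f::field) \<noteq> 2"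
  shows "(2::'f) \<noteq> 0"
proof
  assume "(2::'f) = 0"
  then have "CHAR('f) = 2"
    by (intro CHAR_eq_posI) (auto simp: less_2_cases_iff)
  with assms show False by contradiction
qed

context
  fixes \<alpha> \<beta> \<gamma> \<psi> :: "'f::field"
begin

text \<open>
  With \<open>t = g a b * g b c * g c a\<close>, a pair \<open>(u, v)\<close> stands for \<open>u + v * t\<close> in position \<open>(i, i)\<close>
  and for \<open>u * g i j + v * g i k * g k j\<close>, with \<open>k\<close> the third generator, in position \<open>(i, j)\<close>.
  The other cyclic product is \<open>2 * \<psi> - t\<close>, and its product with \<open>t\<close> is \<open>\<alpha> * \<beta> * \<gamma>\<close>.
  Multiplication by position \<open>(i, i)\<close> depends on whether \<open>i \<rightarrow> j\<close> follows the orientation of \<open>t\<close>.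
\<close>

fun diag_act :: "gen \<Rightarrow> gen \<Rightarrow> 'f \<times> 'f \<Rightarrow> 'f \<times> 'f \<Rightarrow> 'f \<times> 'f" where
  "diag_act i j (u, v) (u', v') =
     (let k = third i j; l = lam \<alpha> \<beta> \<gamma> i j; l' = lam \<alpha> \<beta> \<gamma> i k * lam \<alpha> \<beta> \<gamma> k j in
      if j = nxt i then (u * u' + v * (2 * \<psi> * u' + l' * v'), u * v' - v * l * u')
      else (u * u' - v * l' * v', u * v' + v * (l * u' + 2 * \<psi> * v')))"

text \<open>Composes positions \<open>(i, j)\<close> and \<open>(j, k)\<close>. For
  \<open>i = j = k\<close> this is the ring F[t]/(t^2 - 2 \<psi> t + \<alpha> \<beta> \<gamma>). For
  distinct indices the cyclic sum gives g_ik g_kj g_ji g_ik = 2 \<psi> g_ik - lam_ik g_ij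
  g_jk.\<close>

fun path_comp :: "gen \<Rightarrow> gen \<Rightarrow> gen \<Rightarrow> 'f \<times> 'f \<Rightarrow> 'f \<times> 'f \<Rightarrow> 'f \<times> 'f" where
  "path_comp i j k (u, v) (u', v') =
     (if i = j \<and> j = k then (u * u' - \<alpha> * \<beta> * \<gamma> * v * v', u * v' + v * u' + 2 * \<psi> * v * v')
      else if i = j then diag_act i k (u, v) (u', v')
      else if j = k then diag_act i k (u', v') (u, v)
      else if i = k then
        (let h = third i j;
             d = lam \<alpha> \<beta> \<gamma> i j * u * u' + lam \<alpha> \<beta> \<gamma> i h * lam \<alpha> \<beta> \<gamma> h j * v * v' in
         if j = nxt i then (d + 2 * \<psi> * v * u', u * v' - v * u')
         else (d + 2 * \<psi> * u * v', v * u' - u * v'))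
      else
        (lam \<alpha> \<beta> \<gamma> i j * u * v' + lam \<alpha> \<beta> \<gamma> j k * v * u' + 2 * \<psi> * v * v',
         u * u' - lam \<alpha> \<beta> \<gamma> i k * v * v'))"

lemma path_comp_add_left: "path_comp i j k (x + x') y = path_comp i j k x y + path_comp i j k x' y"
  by (cases x; cases x'; cases y) (simp add: Let_def algebra_simps)

lemma path_comp_add_right: "path_comp i j k x (y + y') = path_comp i j k x y + path_comp i j k x y'"
  by (cases x; cases y; cases y') (simp add: Let_def algebra_simps)

text \<open>For each of the 81 index quadruples this is a polynomial identity in the parameters,
  hence valid for degenerate ones too.\<close>

lemma path_comp_assoc: "path_comp i k l (path_comp i j k x y) z = path_comp i j l x (path_comp j k l y z)"
  by (cases x; cases y; cases z; cases i; cases j; cases k; cases l;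
      simp add: lam_def; simp add: algebra_simps)

definition mat_mult :: "('f \<times> 'f)^gen^gen \<Rightarrow> ('f \<times> 'f)^gen^gen \<Rightarrow> ('f \<times> 'f)^gen^gen" where
  "mat_mult X Y = (\<chi> i k. \<Sum>j\<in>UNIV. path_comp i j k (X $ i $ j) (Y $ j $ k))"

lemma mat_mult_add_left: "mat_mult (X + Y) Z = mat_mult X Z + mat_mult Y Z"
  by (simp add: mat_mult_def vec_eq_iff path_comp_add_left sum.distrib)

lemma mat_mult_add_right: "mat_mult X (Y + Z) = mat_mult X Y + mat_mult X Z"
  by (simp add: mat_mult_def vec_eq_iff path_comp_add_right sum.distrib)

lemma mat_mult_assoc: "mat_mult (mat_mult X Y) Z = mat_mult X (mat_mult Y Z)"
  by (simp add: mat_mult_def vec_eq_iff path_comp_add_left path_comp_add_right path_comp_assoc UNIV_gen ac_simps)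

text \<open>The pair \<open>(1, 0)\<close> is the Gram entry in every position, on and off the diagonal.\<close>

definition sandwich_mult :: "('f \<times> 'f)^gen^gen \<Rightarrow> ('f \<times> 'f)^gen^gen \<Rightarrow> ('f \<times> 'f)^gen^gen" where
  "sandwich_mult X Y = mat_mult (mat_mult X (\<chi> i j. (1, 0))) Y"

lemma sandwich_mult_add_left: "sandwich_mult (X + Y) Z = sandwich_mult X Z + sandwich_mult Y Z"
  by (simp add: sandwich_mult_def mat_mult_add_left)

lemma sandwich_mult_add_right: "sandwich_mult X (Y + Z) = sandwich_mult X Y + sandwich_mult X Z"
  by (simp add: sandwich_mult_def mat_mult_add_right)

lemma sandwich_mult_assoc:
  "sandwich_mult (sandwich_mult X Y) Z = sandwich_mult X (sandwich_mult Y Z)"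
  by (simp add: sandwich_mult_def mat_mult_assoc)

end

text \<open>A symbol \<open>x(yz)\<close> goes to a quarter of the sum of the words \<open>xyz\<close>, \<open>xzy\<close>, \<open>yzx\<close>, \<open>zyx\<close>,
  whose end points are \<open>x\<close> and one of the other two generators.\<close>

definition embed :: "'f::field^mon \<Rightarrow> ('f \<times> 'f)^gen^gen" where
  "embed v = (\<chi> i j. if i = j then (v $ M1 i, 0)
     else (v $ M2 (third i j) / 2, (v $ M3 i + v $ M3 j) / 4))"

lemma embed_add: "embed (v + w) = embed v + embed w"
  by (simp add: embed_def vec_eq_iff add_divide_distrib algebra_simps)

lemma inj_embed:
  assumes "(2::'f::field) \<noteq> 0"
  shows "inj (embed :: 'f^mon \<Rightarrow> _)"
proof (rule injI)
  fix v w :: "'f^mon"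
  assume "embed v = embed w"
  then have *: "embed v $ i $ j = embed w $ i $ j" for i j by simp
  have four: "(4::'f) \<noteq> 0" using assms by (metis mult_2 mult_eq_0_iff numeral_Bit0)
  have M3: "v $ M3 i + v $ M3 j = w $ M3 i + w $ M3 j"
    and M2: "v $ M2 (third i j) = w $ M2 (third i j)" if "i \<noteq> j" for i j
    using *[of i j] that four assms
    by (simp_all only: embed_def vec_lambda_beta if_False prod.inject divide_cancel_right simp_thms)
  \<comment> \<open>Three pairwise sums determine the double of each summand.\<close>
  have "2 * v $ M3 i = 2 * w $ M3 i" for i
    using M3[of Ga Gb, simplified] M3[of Gb Gc, simplified] M3[of Ga Gc, simplified]
    by (cases i; hypsubst_thin; algebra)
  then have "v $ M3 i = w $ M3 i" for i using assms by simp
  moreover have "v $ M1 i = w $ M1 i" for i using *[of i i] by (simp add: embed_def)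
  moreover have "v $ M2 i = w $ M2 i" for i
    using M2[of "nxt i" "nxt (nxt i)"] by (cases i) simp_all
  ultimately show "v = w" unfolding vec_eq_iff by (metis mon.exhaust)
qed

lemma embed_A_mult_axis:
  fixes \<alpha> \<beta> \<gamma> \<psi> c d :: "'f::field" and i j :: mon
  assumes "(2::'f) \<noteq> 0"
  shows "embed (A_mult \<alpha> \<beta> \<gamma> \<psi> (c *s axis i 1) (d *s axis j 1)) +
      embed (A_mult \<alpha> \<beta> \<gamma> \<psi> (c *s axis i 1) (d *s axis j 1)) =
    sandwich_mult \<alpha> \<beta> \<gamma> \<psi> (embed (c *s axis i 1)) (embed (d *s axis j 1)) +
    sandwich_mult \<alpha> \<beta> \<gamma> \<psi> (embed (d *s axis j 1)) (embed (c *s axis i 1))"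
proof -
  have A: "A_mult \<alpha> \<beta> \<gamma> \<psi> (c *s axis i 1) (d *s axis j 1) =
      (c * d) *s basis_mult \<alpha> \<beta> \<gamma> \<psi> i j"
  proof -
    have scale: "A_mult \<alpha> \<beta> \<gamma> \<psi> p (b *s q) = b *s A_mult \<alpha> \<beta> \<gamma> \<psi> p q" for b p q
      using linear_A_mult[of \<alpha> \<beta> \<gamma> \<psi> p] unfolding Vector_Spaces.linear_iff by blast
    then have "A_mult \<alpha> \<beta> \<gamma> \<psi> (b *s p) q = b *s A_mult \<alpha> \<beta> \<gamma> \<psi> p q" for b p q
      by (simp only: A_mult_commute[of \<alpha> \<beta> \<gamma> \<psi> _ q])
    then show ?thesis by (simp add: scale A_mult_axis mult.commute)
  qed
  \<comment> \<open>Clearing denominators needs each numeral power of two to be nonzero.\<close>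
  have pow: "(2::'f) ^ n \<noteq> 0" for n using assms by simp
  note nz = pow[of 1, simplified] pow[of 2, simplified] pow[of 3, simplified] pow[of 4, simplified]
    pow[of 5, simplified] pow[of 6, simplified] pow[of 7, simplified] pow[of 8, simplified]
    pow[of 9, simplified] pow[of 10, simplified] pow[of 11, simplified] pow[of 12, simplified]
  note defs = bas1_def bas2_def bas3_def rhs2_def rhs3_def rhs4_def rhs5_def rhs6_def
    rhs7_def rhs8_def rhs9_def rhs10_def lam_def axis_def embed_def
    sandwich_mult_def mat_mult_def UNIV_gen
  have gen: "\<forall>i. P i" if "P Ga" "P Gb" "P Gc" for P
  proof
    show "P i" for i using that by (cases i) simp_all
  qed
  have mon: "P i" if "P (M1 Ga)" "P (M1 Gb)" "P (M1 Gc)" "P (M2 Ga)" "P (M2 Gb)" "P (M2 Gc)"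
    "P (M3 Ga)" "P (M3 Gb)" "P (M3 Gc)" for P and i :: mon
    by (cases i; rename_tac x; case_tac x; simp add: that)
  show ?thesis
    unfolding A vec_eq_iff
    by (rule mon[of _ i]; rule mon[of _ j]; rule gen; rule gen; simp add: defs nz;
        simp add: field_simps nz)
qed

lemma embed_A_mult:
  fixes \<alpha> \<beta> \<gamma> \<psi> :: "'f::field" and p q :: "'f^mon"
  assumes "(2::'f) \<noteq> 0"
  defines "m \<equiv> sandwich_mult \<alpha> \<beta> \<gamma> \<psi>"
  shows "embed (A_mult \<alpha> \<beta> \<gamma> \<psi> p q) + embed (A_mult \<alpha> \<beta> \<gamma> \<psi> p q) =
    m (embed p) (embed q) + m (embed q) (embed p)"
proof -
  let ?A = "A_mult \<alpha> \<beta> \<gamma> \<psi>"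
  have add: "?A p (q + r) = ?A p q + ?A p r" for p q r
    using linear_A_mult[of \<alpha> \<beta> \<gamma> \<psi> p] unfolding Vector_Spaces.linear_iff by blast
  have add': "?A (q + r) p = ?A q p + ?A r p" for p q r
    by (simp only: add A_mult_commute[of \<alpha> \<beta> \<gamma> \<psi> _ p])
  have left: "Modules.additive (\<lambda>p. embed (?A p q) + embed (?A p q))"
    "Modules.additive (\<lambda>p. m (embed p) (embed q) + m (embed q) (embed p))" for q
    by (simp_all only: Modules.additive_def add' m_def embed_add sandwich_mult_add_left
        sandwich_mult_add_right ac_simps simp_thms)
  have right: "Modules.additive (\<lambda>q. embed (?A p q) + embed (?A p q))"
    "Modules.additive (\<lambda>q. m (embed p) (embed q) + m (embed q) (embed p))" for p
    by (simp_all only: Modules.additive_def add m_def embed_add sandwich_mult_add_left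
        sandwich_mult_add_right ac_simps simp_thms)
  show ?thesis
    by (rule additive_eqI[OF left], rule additive_eqI[OF right])
      (unfold m_def, rule embed_A_mult_axis[OF assms(1)])
qed

theorem proposition4:
  fixes \<alpha> \<beta> \<gamma> \<psi> :: "'f::field"
  assumes "CHAR('f) \<noteq> 2"
  shows "jordan_algebra (*s) (A_mult \<alpha> \<beta> \<gamma> \<psi>)"
proof -
  have two: "(2::'f) \<noteq> 0" using assms by (rule two_neq_zero)
  interpret commutative_algebra "(*s)" "A_mult \<alpha> \<beta> \<gamma> \<psi>" by (rule commutative_algebra_A_mult)
  have torsion: "x = y" if "x + x = y + y" for x y :: "('f \<times> 'f)^gen^gen"
    using that two by (simp add: vec_eq_iff prod_eq_iff flip: mult_2)
  show ?thesis
    by (rule jordan_algebraI_special[OF sandwich_mult_add_left sandwich_mult_add_right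
          sandwich_mult_assoc torsion inj_embed[OF two] embed_A_mult[OF two]])
qed

end
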